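(* For every integer $m>4$ there exist infinitely many integral closed 2-friezes of width $m$.
   Context: A closed 2-frieze of width $m$ is an array $a(r,c)$, with rows $r\in\{0,1,\dots,m+1\}$ (numbered from top to bottom) and columns $c\in\mathbb{Z}$ (numbered from left to right), whose top and bottom rows consist of 1s, i.e. $a(0,c)=a(m+1,c)=1$ for all $c\in\mathbb{Z}$, and which satisfies the local rule that every entry equals the determinant formed by its four neighbors: $$a(r,c)=a(r,c-1)\,a(r,c+1)-a(r-1,c)\,a(r+1,c)\qquad (1\le r\le m,\ c\in\mathbb{Z}).$$ A closed 2-frieze is integral if all its entries are positive integers. *)

theory Defs
  imports Main "HOL-Library.FuncSet"
begin

(* An array has rows 0, ..., m+1 only. Extensionality fixes the values outside these
   rows, so that distinct functions represent distinct arrays. *)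
definition closed_2_frieze :: "nat \<Rightarrow> (nat \<times> int \<Rightarrow> 'a::comm_ring_1) \<Rightarrow> bool" where
  "closed_2_frieze m a \<longleftrightarrow>
     a \<in> extensional ({0..m+1} \<times> UNIV) \<and>
     (\<forall>c. a (0, c) = 1 \<and> a (m+1, c) = 1) \<and>
     (\<forall>r\<in>{1..m}. \<forall>c. a (r, c) = a (r, c-1) * a (r, c+1) - a (r-1, c) * a (r+1, c))"

definition integral_closed_2_frieze :: "nat \<Rightarrow> (nat \<times> int \<Rightarrow> int) \<Rightarrow> bool" where
  "integral_closed_2_frieze m a \<longleftrightarrow>
     closed_2_frieze m a \<and> (\<forall>r\<in>{0..m+1}. \<forall>c. a (r, c) > 0)"

end

(*
  For n = m + 4, let V_i be an n-periodic sequence in Z^3 with det(V_i, V_{i+1}, V_{i+2}) = 1.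
  By the Pluecker relations the minors det(V_i, V_{i+1}, V_j) form a closed 2-frieze of width m,
  so it suffices to find such sequences with all these minors positive.

  We take k + 1 points (1, q, q(q-1)/2), q = 0, ..., k, on a parabola, where k = m - 5, and close
  the polygon with a "cap" of eight points. The minors of points on the parabola are Vandermonde
  determinants, and this makes positivity independent of k. The cap depends on a solution of
  x^2 + y^2 + 1 = 3xy; these are infinite in number because (x, y) can be replaced by (y, 3y - x).
*)
theory Submission
  imports Defs
begin

section \<open>Friezes from polygons\<close>

fun det3 :: "'a \<times> 'a \<times> 'a \<Rightarrow> 'a \<times> 'a \<times> 'a \<Rightarrow> 'a \<times> 'a \<times> 'a \<Rightarrow> 'a::comm_ring_1" where
  "det3 (a1, a2, a3) (b1, b2, b3) (c1, c2, c3) =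
     a1 * (b2 * c3 - b3 * c2) - a2 * (b1 * c3 - b3 * c1) + a3 * (b1 * c2 - b2 * c1)"

lemma det3_rotate: "det3 a b c = det3 b c a"
  by (cases a; cases b; cases c) (simp add: algebra_simps)

text \<open>All six determinants contain \<open>v\<close>, so this is the three-term Pluecker
  relation of the plane obtained by dividing out \<open>v\<close>.\<close>

lemma det3_pluecker:
  "det3 p q v * det3 u v w = det3 p u v * det3 q v w - det3 p v w * det3 q u v"
proof (cases p; cases q; cases u; cases v; cases w)
  fix p1 p2 p3 q1 q2 q3 u1 u2 u3 v1 v2 v3 w1 w2 w3 :: 'a
  assume "p = (p1, p2, p3)" "q = (q1, q2, q3)" "u = (u1, u2, u3)" "v = (v1, v2, v3)"
    "w = (w1, w2, w3)"
  then show ?thesis by (simp add: algebra_simps)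
qed

text \<open>The odd case reads \<open>k + 1 = 2 * j\<close> so that \<open>j\<close> is
  \<open>(k + 1) div 2\<close> in both cases, the index used by
  \<open>polygon_frieze\<close>.\<close>

lemma int_parity_cases:
  obtains (odd) j where "(k::int) + 1 = 2 * j" | (even) j where "k = 2 * j"
proof -
  have "\<exists>j. k + 1 = 2 * j \<or> k = 2 * j" by presburger
  then show ?thesis using that by blast
qed

text \<open>Each entry is a minor of an adjacent pair and a single vector. The parity decides which
  of them comes first, and the row counts the indices strictly between them.\<close>

definition polygon_frieze :: "nat \<Rightarrow> (int \<Rightarrow> 'a \<times> 'a \<times> 'a) \<Rightarrow> nat \<times> int \<Rightarrow> 'a::comm_ring_1" where
  "polygon_frieze m V = restrict (\<lambda>(r, c).
     let j = (int r + c + 1) div 2; i = j - int r - 1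
     in if odd (int r + c) then det3 (V (i - 1)) (V i) (V j) else det3 (V i) (V j) (V (j + 1)))
   ({0..m+1} \<times> UNIV)"

lemma polygon_frieze_odd:
  assumes "r \<le> m + 1" "int r + c + 1 = 2 * j" "i = j - int r - 1"
  shows "polygon_frieze m V (r, c) = det3 (V (i - 1)) (V i) (V j)"
proof -
  have "odd (int r + c)" "(int r + c + 1) div 2 = j" using assms(2) by presburger+
  then show ?thesis using assms(1,3) by (simp add: polygon_frieze_def Let_def)
qed

lemma polygon_frieze_even:
  assumes "r \<le> m + 1" "int r + c = 2 * j" "i = j - int r - 1"
  shows "polygon_frieze m V (r, c) = det3 (V i) (V j) (V (j + 1))"
proof -
  have "even (int r + c)" "(int r + c + 1) div 2 = j" using assms(2) by presburger+
  then show ?thesis using assms(1,3) by (simp add: polygon_frieze_def Let_def)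
qed

lemma polygon_frieze_closed:
  fixes V :: "int \<Rightarrow> 'a \<times> 'a \<times> 'a::comm_ring_1"
  assumes periodic: "\<And>i. V (i + (int m + 4)) = V i"
    and unimodular: "\<And>i. det3 (V i) (V (i + 1)) (V (i + 2)) = 1"
  shows "closed_2_frieze m (polygon_frieze m V)"
proof -
  have middle: "det3 (V (i - 1)) (V i) (V (i + 1)) = 1" for i
    using unimodular[of "i - 1"] by (simp add: add.commute)
  show ?thesis
    unfolding closed_2_frieze_def
  proof (intro conjI allI ballI)
    show "polygon_frieze m V \<in> extensional ({0..m+1} \<times> UNIV)"
      by (simp add: polygon_frieze_def)
  next
    fix c
    show "polygon_frieze m V (0, c) = 1"
    proof (cases "c" rule: int_parity_cases)
      case (odd j)
      then show ?thesis
        using polygon_frieze_odd[of 0 m c j "j - 1" V] unimodular[of "j - 2"] by simp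
    next
      case (even j)
      then show ?thesis
        using polygon_frieze_even[of 0 m c j "j - 1" V] middle[of j] by simp
    qed
  next
    fix c
    show "polygon_frieze m V (m + 1, c) = 1"
    proof (cases "int (m + 1) + c" rule: int_parity_cases)
      case j: (odd j)
      define i where "i = j - int m - 2"
      have "polygon_frieze m V (m + 1, c) = det3 (V (i - 1)) (V i) (V j)"
        using j by (intro polygon_frieze_odd) (auto simp: i_def)
      \<comment> \<open>In the last row the single vector, moved back one period, is adjacent to the
        pair.\<close>
      also have "V j = V (i - 2)" using periodic[of "i - 2"] by (simp add: i_def algebra_simps)
      also have "det3 (V (i - 1)) (V i) (V (i - 2)) = det3 (V (i - 2)) (V (i - 1)) (V i)"
        using det3_rotate by metis
      finally show ?thesis using unimodular[of "i - 2"] by simp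
    next
      case j: (even j)
      define i where "i = j - int m - 2"
      have "polygon_frieze m V (m + 1, c) = det3 (V i) (V j) (V (j + 1))"
        using j by (intro polygon_frieze_even) (auto simp: i_def)
      also have "V j = V (i - 2)" using periodic[of "i - 2"] by (simp add: i_def algebra_simps)
      also have "V (j + 1) = V (i - 1)" using periodic[of "i - 1"] by (simp add: i_def algebra_simps)
      also have "det3 (V i) (V (i - 2)) (V (i - 1)) = det3 (V (i - 2)) (V (i - 1)) (V i)"
        using det3_rotate by metis
      finally show ?thesis using unimodular[of "i - 2"] by simp
    qed
  next
    fix r c
    assume "r \<in> {1..m}"
    then have r: "1 \<le> r" "r \<le> m" by auto
    let ?a = "polygon_frieze m V"
    show "?a (r, c) = ?a (r, c-1) * ?a (r, c+1) - ?a (r-1, c) * ?a (r+1, c)"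
    proof (cases "int r + c" rule: int_parity_cases)
      case j: (odd j)
      define i where "i = j - int r - 1"
      have "?a (r, c) = det3 (V (i - 1)) (V i) (V j)"
        using j r by (intro polygon_frieze_odd) (auto simp: i_def)
      moreover have "?a (r, c - 1) = det3 (V (i - 1)) (V (j - 1)) (V j)"
        using j r polygon_frieze_even[of r m "c - 1" "j - 1" "i - 1" V] by (simp add: i_def)
      moreover have "?a (r, c + 1) = det3 (V i) (V j) (V (j + 1))"
        using j r by (intro polygon_frieze_even) (auto simp: i_def)
      moreover have "?a (r - 1, c) = det3 (V i) (V (j - 1)) (V j)"
        using j r polygon_frieze_even[of "r - 1" m c "j - 1" i V] by (simp add: i_def of_nat_diff)
      moreover have "?a (r + 1, c) = det3 (V (i - 1)) (V j) (V (j + 1))"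
        using j r by (intro polygon_frieze_even) (auto simp: i_def)
      \<comment> \<open>Pluecker relation with common vector \<open>V j\<close>; the minor around
        \<open>V j\<close> is 1, so one product collapses to the entry.\<close>
      ultimately show ?thesis
        using middle[of j] det3_pluecker[of "V (i - 1)" "V i" "V j" "V (j - 1)" "V (j + 1)"]
        by (simp add: mult.commute)
    next
      case j: (even j)
      define i where "i = j - int r - 1"
      have "?a (r, c) = det3 (V i) (V j) (V (j + 1))"
        using j r by (intro polygon_frieze_even) (auto simp: i_def)
      moreover have "?a (r, c - 1) = det3 (V (i - 1)) (V i) (V j)"
        using j r by (intro polygon_frieze_odd) (auto simp: i_def)
      moreover have "?a (r, c + 1) = det3 (V i) (V (i + 1)) (V (j + 1))"
        using j r polygon_frieze_odd[of r m "c + 1" "j + 1" "i + 1" V] by (simp add: i_def)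
      moreover have "?a (r - 1, c) = det3 (V i) (V (i + 1)) (V j)"
        using j r polygon_frieze_odd[of "r - 1" m c j "i + 1" V] by (simp add: i_def of_nat_diff)
      moreover have "?a (r + 1, c) = det3 (V (i - 1)) (V i) (V (j + 1))"
        using j r polygon_frieze_odd[of "r + 1" m c "j + 1" i V] by (simp add: i_def)
      \<comment> \<open>The mirror image, with common vector \<open>V i\<close>.\<close>
      ultimately show ?thesis
        using middle[of i] det3_pluecker[of "V j" "V (j + 1)" "V i" "V (i - 1)" "V (i + 1)"]
        by (simp add: det3_rotate[of "V j"] det3_rotate[of "V (j + 1)"] mult.commute)
    qed
  qed
qed

lemma polygon_frieze_integral:
  assumes periodic: "\<And>i. V (i + (int m + 4)) = V i"
    and unimodular: "\<And>i. det3 (V i) (V (i + 1)) (V (i + 2)) = 1"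
    and positive: "\<And>i j. i + 1 < j \<Longrightarrow> j < i + (int m + 4) \<Longrightarrow> det3 (V i) (V (i + 1)) (V j) > 0"
  shows "integral_closed_2_frieze m (polygon_frieze m V)"
  unfolding integral_closed_2_frieze_def
proof (intro conjI allI ballI)
  show "closed_2_frieze m (polygon_frieze m V)"
    by (rule polygon_frieze_closed) (fact periodic unimodular)+
next
  fix r c
  assume "r \<in> {0..m+1}"
  then have r: "r \<le> m + 1" by simp
  show "polygon_frieze m V (r, c) > 0"
  proof (cases "int r + c" rule: int_parity_cases)
    case j: (odd j)
    then show ?thesis
      using polygon_frieze_odd[OF r j refl, of V] positive[of "j - int r - 2" j] r
      by (simp add: algebra_simps)
  next
    case j: (even j)
    define i where "i = j - int r - 1"
    have "polygon_frieze m V (r, c) = det3 (V i) (V j) (V (j + 1))"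
      using polygon_frieze_even[OF r j refl, of V] by (simp add: i_def)
    \<comment> \<open>Rotation and periodicity bring the adjacent pair to the front, as
      \<open>positive\<close> requires.\<close>
    also have "\<dots> = det3 (V j) (V (j + 1)) (V (i + (int m + 4)))"
      using det3_rotate periodic by metis
    finally show ?thesis using positive[of j "i + (int m + 4)"] r by (simp add: i_def)
  qed
qed

section \<open>Closing up a chain of vectors\<close>

text \<open>Reduces the conditions on a periodic sequence to a single period; the triples that cross
  its end have hypotheses of their own.\<close>

lemma polygon_frieze_cyclic:
  fixes f :: "int \<Rightarrow> int \<times> int \<times> int" and m :: nat
  defines "n \<equiv> int m + 4"
  assumes unimodular: "\<And>p. 0 \<le> p \<Longrightarrow> p + 2 < n \<Longrightarrow> det3 (f p) (f (p + 1)) (f (p + 2)) = 1"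
    and unimodular_wrap: "det3 (f (n - 2)) (f (n - 1)) (f 0) = 1" "det3 (f (n - 1)) (f 0) (f 1) = 1"
    and positive: "\<And>p q. 0 \<le> p \<Longrightarrow> p + 1 < n \<Longrightarrow> 0 \<le> q \<Longrightarrow> q < n \<Longrightarrow> q \<noteq> p \<Longrightarrow> q \<noteq> p + 1 \<Longrightarrow>
      det3 (f p) (f (p + 1)) (f q) > 0"
    and positive_wrap: "\<And>q. 0 < q \<Longrightarrow> q < n - 1 \<Longrightarrow> det3 (f (n - 1)) (f 0) (f q) > 0"
  shows "integral_closed_2_frieze m (polygon_frieze m (\<lambda>i. f (i mod n)))"
proof (rule polygon_frieze_integral)
  have n: "n > 3" by (simp add: n_def)
  have shift: "(i + d) mod n = (if i mod n + d < n then i mod n + d else i mod n + d - n)"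
    if "0 \<le> d" "d < n" for i d
  proof -
    have "(i + d) mod n = (i mod n + d) mod n" by (simp add: mod_simps)
    also have "\<dots> = (if i mod n + d < n then i mod n + d else i mod n + d - n)"
    proof (cases "i mod n + d < n")
      case True
      then show ?thesis using that n by (simp add: mod_pos_pos_trivial)
    next
      case False
      have "(i mod n + d) mod n = (i mod n + d - n) mod n" by simp
      also have "\<dots> = i mod n + d - n"
        using False that n pos_mod_bound[of n i] by (intro mod_pos_pos_trivial) linarith+
      finally show ?thesis using False by simp
    qed
    finally show ?thesis .
  qed
  fix i :: int
  have p: "0 \<le> i mod n" "i mod n < n" using n by auto
  show "f ((i + (int m + 4)) mod n) = f (i mod n)" by (simp add: n_def)
  show "det3 (f (i mod n)) (f ((i + 1) mod n)) (f ((i + 2) mod n)) = 1"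
  proof -
    consider "i mod n + 2 < n" | "i mod n = n - 2" | "i mod n = n - 1" using p by linarith
    then show ?thesis
      by cases (use p n unimodular[of "i mod n"] unimodular_wrap in \<open>auto simp: shift\<close>)
  qed
  fix j :: int
  assume j: "i + 1 < j" "j < i + (int m + 4)"
  define d where "d = j - i"
  have d: "1 < d" "d < n" "j = i + d" using j by (auto simp: d_def n_def)
  show "det3 (f (i mod n)) (f ((i + 1) mod n)) (f (j mod n)) > 0"
  proof (cases "i mod n = n - 1")
    case True
    then show ?thesis using d n positive_wrap[of "d - 1"] by (simp add: shift)
  next
    case False
    define q where "q = (if i mod n + d < n then i mod n + d else i mod n + d - n)"
    have "i mod n + 1 < n" using False p by linarith
    moreover have "0 \<le> q" "q < n" "q \<noteq> i mod n" "q \<noteq> i mod n + 1"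
      unfolding q_def using p d by (smt (verit))+
    ultimately have "det3 (f (i mod n)) (f (i mod n + 1)) (f q) > 0"
      using p positive by blast
    then show ?thesis using d n \<open>i mod n + 1 < n\<close> by (simp add: shift q_def)
  qed
qed

section \<open>The polygons\<close>

definition triangular :: "int \<Rightarrow> int" where
  "triangular q = q * (q - 1) div 2"

lemma double_triangular: "2 * triangular q = q * q - q"
proof -
  have "even (q * (q - 1))" by simp
  then show ?thesis by (simp add: triangular_def algebra_simps)
qed

lemma triangular_0 [simp]: "triangular 0 = 0"
  by (simp add: triangular_def)

lemma triangular_Suc [simp]: "triangular (q + 1) = triangular q + q"
  using double_triangular[of "q + 1"] double_triangular[of q] by (simp add: algebra_simps)

lemma triangular_nonneg: "triangular q \<ge> 0"
proof -
  have "q * (q - 1) \<ge> 0" by (cases "q \<le> 0") (auto simp: zero_le_mult_iff)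
  then show ?thesis using double_triangular[of q] by (simp add: algebra_simps)
qed

text \<open>With \<open>triangular q\<close> in place of \<open>q * q\<close>, three consecutive
  points have determinant 1 instead of 2.\<close>

definition node :: "int \<Rightarrow> int \<times> int \<times> int" where
  "node q = (1, q, triangular q)"

lemma node_Suc: "node (p + 1) = (1, p + 1, triangular p + p)"
  by (simp add: node_def)

text \<open>Half the Vandermonde determinant of \<open>p\<close>, \<open>p + 1\<close>,
  \<open>q\<close>, doubled to avoid a division.\<close>

lemma det3_nodes: "2 * det3 (node p) (node (p + 1)) (node q) = (q - p) * (q - p - 1)"
  using double_triangular[of p] double_triangular[of q]
  by (simp add: node_Suc) (simp add: node_def algebra_simps)

text \<open>
  For \<open>k = 0\<close> the polygon has nine vertices and its minors are cluster variables of the Grassmannian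
  Gr(3,9). The pairs \<open>(x, y)\<close> come from mutating alternately at the two ends of a double arrow, with
  exchange relation \<open>x x' = y\<^sup>2 + 1\<close> when all the other variables of the seed are \<open>1\<close>.
\<close>

definition cap :: "int \<Rightarrow> int \<Rightarrow> (int \<times> int \<times> int) list" where
  "cap x y =
    [(0, 0, 1),
     (0, -1, 2),
     (1, - 4*x - 13*y, 7*x + 20*y),
     (10*x + 15*y, 200 + 155*x*x - 775*x*y, 1205*x*y - 230*x*x - 309),
     (5*x + 10*y, 134 + 110*x*x - 495*x*y, 770*x*y - 165*x*x - 207),
     (1, - x - 11*y, 2*x + 17*y),
     (x + y, -2, 3),
     (x + 6*y, -1, 1)]"

section \<open>Estimates for the cap vectors\<close>

context
  fixes x y :: int
  assumes xy: "1 \<le> x" "x \<le> y" "x * x + y * y + 1 = 3 * x * y"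
begin

text \<open>As rewrite rules these lower the degree in \<open>y\<close> to at most one; the second
  form catches \<open>y * y\<close> inside a longer product.\<close>

lemma reduce_square:
  "y * y = 3 * (x * y) - x * x - 1"
  "y * (y * z) = 3 * (x * (y * z)) - x * (x * z) - z"
proof -
  show yy: "y * y = 3 * (x * y) - x * x - 1" using xy(3) by simp
  show "y * (y * z) = 3 * (x * (y * z)) - x * (x * z) - z"
    using arg_cong[OF yy, of "\<lambda>w. w * z"] by (simp add: algebra_simps)
qed

text \<open>With these bounds and \<open>1 \<le> x \<le> y\<close>, linear arithmetic settles the
  reduced inequalities, treating \<open>x * x\<close> and \<open>x * y\<close> as atoms.\<close>

lemma monomial_bounds: "1 \<le> x * x" "x * x \<le> x * y"
  using xy(1,2) mult_mono[of 1 x 1 x] by simp_all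

lemmas cap_expand = cap_def atLeastLessThan_nat_numeral numeral_nat atLeast0_lessThan_Suc

lemma cap_positive:
  "\<forall>s\<in>{0..<7}. \<forall>u\<in>{0..<8}. u \<noteq> s \<longrightarrow> u \<noteq> s + 1 \<longrightarrow>
      det3 (cap x y ! s) (cap x y ! (s + 1)) (cap x y ! u) > 0"
  using xy(1,2)
  by (simp add: cap_expand algebra_simps reduce_square)
    (intro conjI; use monomial_bounds in linarith)

lemma cap_unimodular:
  "\<forall>s\<in>{0..<6}. det3 (cap x y ! s) (cap x y ! (s + 1)) (cap x y ! (s + 2)) = 1"
  by (simp add: cap_expand algebra_simps reduce_square)

text \<open>Sign pattern behind the positivity of mixed minors. The two exceptions are real:
  \<open>b = 0\<close> at position 0 and \<open>b + c = 0\<close> at position 7.\<close>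

lemma cap_signs:
  assumes "u < 8" "cap x y ! u = (a, b, c)"
  shows "0 \<le> a" "b \<le> 0" "0 < c" "0 < u \<Longrightarrow> b < 0" "u < 7 \<Longrightarrow> 0 < b + c"
proof -
  have "\<forall>u\<in>{0..<8}. case cap x y ! u of (a, b, c) \<Rightarrow>
    0 \<le> a \<and> b \<le> 0 \<and> 0 < c \<and> (0 < u \<longrightarrow> b < 0) \<and> (u < 7 \<longrightarrow> 0 < b + c)"
    using xy(1,2)
    by (simp add: cap_expand algebra_simps) (intro conjI; use monomial_bounds in linarith)
  from bspec[OF this, of u] show "0 \<le> a" "b \<le> 0" "0 < c" "0 < u \<Longrightarrow> b < 0" "u < 7 \<Longrightarrow> 0 < b + c"
    using assms by auto
qed

text \<open>For a fixed cap pair the minor is a linear functional of the third vector. Its values on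
  the standard basis suffice, since \<open>node q\<close> has nonnegative coordinates for
  \<open>0 \<le> q\<close>.\<close>

lemma cap_functional:
  "\<forall>s\<in>{0..<7}. det3 (cap x y ! s) (cap x y ! (s + 1)) (1, 0, 0) > 0 \<and>
     det3 (cap x y ! s) (cap x y ! (s + 1)) (0, 1, 0) \<ge> 0 \<and>
     det3 (cap x y ! s) (cap x y ! (s + 1)) (0, 0, 1) \<ge> 0"
  using xy(1,2)
  by (simp add: cap_expand algebra_simps reduce_square)
    (intro conjI; use monomial_bounds in linarith)

section \<open>Minors mixing nodes and cap vectors\<close>

lemma cap_cap_node:
  assumes "s < 7" "0 \<le> q"
  shows "det3 (cap x y ! s) (cap x y ! (s + 1)) (node q) > 0"
proof -
  let ?d = "det3 (cap x y ! s) (cap x y ! (s + 1))"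
  have "?d (node q) = ?d (1, 0, 0) + q * ?d (0, 1, 0) + triangular q * ?d (0, 0, 1)"
    by (cases "cap x y ! s"; cases "cap x y ! (s + 1)") (simp add: node_def algebra_simps)
  moreover have "?d (1, 0, 0) > 0" "?d (0, 1, 0) \<ge> 0" "?d (0, 0, 1) \<ge> 0"
    using cap_functional assms(1) by auto
  ultimately show ?thesis
    using assms(2) triangular_nonneg[of q] by (simp add: add_pos_nonneg)
qed

lemma cap_cap_node_0: "det3 (cap x y ! 6) (cap x y ! 7) (node 0) = 1"
  by (simp add: cap_expand node_def algebra_simps)

lemma node_node_cap:
  assumes "u < 8" "0 \<le> p"
  shows "det3 (node p) (node (p + 1)) (cap x y ! u) > 0"
proof -
  obtain a b c where abc: "cap x y ! u = (a, b, c)" by (cases "cap x y ! u")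
  have "det3 (node p) (node (p + 1)) (cap x y ! u)
      = c + p * (- b) + a * (p * p - triangular p)"
    unfolding abc node_Suc by (simp add: node_def algebra_simps)
  \<comment> \<open>The coefficient of \<open>a\<close> is again a triangular number, so by
    \<open>cap_signs\<close> every summand is nonnegative and \<open>c\<close> is positive.\<close>
  also have "p * p - triangular p = triangular (p + 1)"
    using double_triangular[of p] by simp
  finally show ?thesis
    using cap_signs(1-3)[OF assms(1) abc] assms(2) triangular_nonneg[of "p + 1"]
    by (simp only:) (intro add_pos_nonneg mult_nonneg_nonneg; simp)
qed

text \<open>The first cap vector \<open>(0, 0, 1)\<close> is the point at infinity of the parabola,
  so the minor is the difference of the two parameters.\<close>

lemma node_node_cap_0: "det3 (node p) (node (p + 1)) (cap x y ! 0) = 1"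
  unfolding node_Suc by (simp add: cap_def node_def)

lemma node_cap_cap:
  assumes "0 < u" "u < 8" "0 \<le> p"
  shows "det3 (node p) (cap x y ! 0) (cap x y ! u) > 0"
proof -
  obtain a b c where abc: "cap x y ! u = (a, b, c)" by (cases "cap x y ! u")
  have "det3 (node p) (cap x y ! 0) (cap x y ! u) = p * a - b"
    unfolding abc by (simp add: node_def cap_def)
  also have "\<dots> > 0"
    using cap_signs(1,4)[OF assms(2) abc] assms(1,3) mult_nonneg_nonneg[of p a] by linarith
  finally show ?thesis .
qed

lemma node_cap_cap_1: "det3 (node p) (cap x y ! 0) (cap x y ! 1) = 1"
  by (simp add: cap_def node_def)

text \<open>Applied with \<open>p = k\<close>, the last node, where the difference is positive for
  every other node.\<close>

lemma node_cap_node: "det3 (node p) (cap x y ! 0) (node q) = p - q"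
  by (simp add: cap_def node_def)

lemma cap_node_cap:
  assumes "u < 7"
  shows "det3 (cap x y ! 7) (node 0) (cap x y ! u) > 0"
proof -
  obtain a b c where abc: "cap x y ! u = (a, b, c)" by (cases "cap x y ! u")
  have "det3 (cap x y ! 7) (node 0) (cap x y ! u) = b + c"
    unfolding abc by (simp add: node_def cap_expand)
  then show ?thesis using cap_signs(5)[OF _ abc] assms by simp
qed

lemma cap_node_cap_0: "det3 (cap x y ! 7) (node 0) (cap x y ! 0) = 1"
  by (simp add: cap_expand node_def)

lemma cap_node_node: "det3 (cap x y ! 7) (node 0) (node q) = triangular q + q"
  by (simp add: cap_expand node_def)

section \<open>Assembly of the polygon\<close>

definition vertex :: "int \<Rightarrow> int \<Rightarrow> int \<times> int \<times> int" where
  "vertex k i = (if i \<le> k then node i else cap x y ! nat (i - k - 1))"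

text \<open>The \<open>k + 1\<close> nodes and eight cap vectors make \<open>k + 9 = m + 4\<close>
  vertices. The cases follow where a triple meets the two seams between nodes and cap.\<close>

lemma integral_polygon_frieze:
  defines "V \<equiv> \<lambda>k i. vertex k (i mod (k + 9))"
  assumes "k = int m - 5" "0 \<le> k"
  shows "integral_closed_2_frieze m (polygon_frieze m (V k))"
proof -
  have m: "int m + 4 = k + 9" using assms by simp
  have node: "vertex k i = node i" if "i \<le> k" for i using that by (simp add: vertex_def)
  have cap: "vertex k i = cap x y ! s" if "i = k + 1 + int s" for i s
    using that by (simp add: vertex_def)
  have split: "i \<le> k \<or> (\<exists>s<8. i = k + 1 + int s)" if "0 \<le> i" "i < k + 9" for i
  proof (cases "i \<le> k")
    case False
    then have "nat (i - k - 1) < 8" "i = k + 1 + int (nat (i - k - 1))" using that by auto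
    then show ?thesis by blast
  qed simp
  show ?thesis
    unfolding V_def m[symmetric]
  proof (rule polygon_frieze_cyclic, unfold m)
    fix p :: int
    assume p: "0 \<le> p" "p + 2 < k + 9"
    consider "p + 2 \<le> k" | "p + 1 = k" | "p = k" | s where "s < 6" "p = k + 1 + int s"
      using p split[of p] by fastforce
    then show "det3 (vertex k p) (vertex k (p + 1)) (vertex k (p + 2)) = 1"
    proof cases
      case 1
      then show ?thesis using det3_nodes[of p "p + 2"] by (simp add: node)
    next
      case 2
      then show ?thesis
        using node_node_cap_0[of p] by (simp add: node cap[of "p + 2" 0])
    next
      case 3
      then show ?thesis
        using node_cap_cap_1[of p] by (simp add: node cap[of "k + 1" 0] cap[of "k + 2" 1])
    next
      case 4
      have "vertex k p = cap x y ! s" "vertex k (p + 1) = cap x y ! (s + 1)"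
        "vertex k (p + 2) = cap x y ! (s + 2)"
        by (rule cap; simp add: 4(2))+
      then show ?thesis using cap_unimodular 4(1) by simp
    qed
  next
    show "det3 (vertex k (k + 9 - 2)) (vertex k (k + 9 - 1)) (vertex k 0) = 1"
      using cap_cap_node_0 assms(3) by (simp add: cap[of _ 6] cap[of _ 7] node)
  next
    show "det3 (vertex k (k + 9 - 1)) (vertex k 0) (vertex k 1) = 1"
    proof (cases "k = 0")
      \<comment> \<open>With a single node, position 1 already holds the first cap vector.\<close>
      case True
      then have "vertex k (k + 9 - 1) = cap x y ! 7" "vertex k 1 = cap x y ! 0"
        by (simp_all add: vertex_def)
      then show ?thesis using cap_node_cap_0 by (simp add: node assms(3))
    next
      case False
      then have "vertex k (k + 9 - 1) = cap x y ! 7" "vertex k 1 = node 1"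
        using assms(3) by (simp_all add: vertex_def)
      then show ?thesis
        using cap_node_node[of 1] triangular_Suc[of 0] by (simp add: node assms(3))
    qed
  next
    fix p q :: int
    assume p: "0 \<le> p" "p + 1 < k + 9" and q: "0 \<le> q" "q < k + 9" "q \<noteq> p" "q \<noteq> p + 1"
    consider "p + 1 \<le> k" | "p = k" | s where "s < 7" "p = k + 1 + int s"
      using p split[of p] by fastforce
    then show "det3 (vertex k p) (vertex k (p + 1)) (vertex k q) > 0"
    proof cases
      case 1
      \<comment> \<open>Consecutive integers have a positive product unless one of them is
        0.\<close>
      have "(q - p) * (q - p - 1) > 0"
        using q(3,4) by (cases "q < p") (auto simp: zero_less_mult_iff)
      then have "det3 (node p) (node (p + 1)) (node q) > 0" using det3_nodes[of p q] by simp
      then show ?thesis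
        using 1 split[OF q(1,2)] node_node_cap[OF _ p(1)] by (auto simp: node cap)
    next
      case 2
      then have v: "vertex k p = node p" "vertex k (p + 1) = cap x y ! 0"
        by (simp_all add: node cap[of _ 0])
      show ?thesis
        using split[OF q(1,2)]
      proof (elim disjE exE conjE)
        assume "q \<le> k"
        then show ?thesis using 2 q(3) unfolding v by (simp add: node node_cap_node)
      next
        fix u :: nat
        assume u: "u < 8" "q = k + 1 + int u"
        then have "0 < u" using 2 q(4) by (cases u) auto
        then show ?thesis using node_cap_cap[OF _ u(1) p(1)] unfolding v cap[OF u(2)] by blast
      qed
    next
      case 3
      then have v: "vertex k p = cap x y ! s" "vertex k (p + 1) = cap x y ! (s + 1)"
        by (simp_all add: cap)
      show ?thesis
        using split[OF q(1,2)]
      proof (elim disjE exE conjE)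
        assume "q \<le> k"
        then show ?thesis using cap_cap_node[OF 3(1) q(1)] by (simp add: v node)
      next
        fix u :: nat
        assume u: "u < 8" "q = k + 1 + int u"
        then have "u \<noteq> s" "u \<noteq> s + 1" using 3 q(3,4) by auto
        then show ?thesis using cap_positive 3(1) u(1) unfolding v cap[OF u(2)] by simp
      qed
    qed
  next
    fix q :: int
    assume q: "0 < q" "q < k + 9 - 1"
    have v: "vertex k (k + 9 - 1) = cap x y ! 7" "vertex k 0 = node 0"
      using assms(3) by (simp_all add: node cap[of _ 7])
    have "0 \<le> q" "q < k + 9" using q by simp_all
    from split[OF this] show "det3 (vertex k (k + 9 - 1)) (vertex k 0) (vertex k q) > 0"
    proof (elim disjE exE conjE)
      assume "q \<le> k"
      then show ?thesis
        using q(1) triangular_nonneg[of q] unfolding v by (simp add: node cap_node_node)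
    next
      fix u :: nat
      assume u: "u < 8" "q = k + 1 + int u"
      then have "u < 7" using q(2) by simp
      then show ?thesis using cap_node_cap unfolding v cap[OF u(2)] by blast
    qed
  qed
qed

text \<open>An entry that grows with the parameters and so tells friezes apart. Its column is chosen
  so that the minor takes the last node and cap vectors 0 and 2.\<close>

lemma polygon_frieze_entry:
  defines "V \<equiv> \<lambda>k i. vertex k (i mod (k + 9))"
  assumes "k = int m - 5" "0 \<le> k"
  shows "polygon_frieze m (V k) (1, 2 * k + 4) = k + 4 * x + 13 * y"
proof -
  have "polygon_frieze m (V k) (1, 2 * k + 4) = det3 (V k k) (V k (k + 1)) (V k (k + 3))"
    using assms(2,3) polygon_frieze_odd[of 1 m "2 * k + 4" "k + 3" "k + 1" "V k"] by simp
  also have "\<dots> = det3 (node k) (cap x y ! 0) (cap x y ! 2)"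
    using assms(3) by (simp add: V_def vertex_def)
  also have "\<dots> = k + 4 * x + 13 * y" by (simp add: cap_def node_def)
  finally show ?thesis .
qed

end

section \<open>Infinitely many friezes\<close>

text \<open>Vieta jumping: for fixed \<open>y\<close> the two roots \<open>x\<close> sum to
  \<open>3 * y\<close>. The strict \<open>x < y\<close> makes the smaller parameter grow at each
  step; hence the start \<open>(1, 2)\<close> rather than \<open>(1, 1)\<close>.\<close>

lemma cap_parameters_unbounded:
  "\<exists>x y :: int. int n < x \<and> x < y \<and> x * x + y * y + 1 = 3 * x * y"
proof (induction n)
  case 0
  have "(1::int) * 1 + 2 * 2 + 1 = 3 * 1 * 2" by simp
  then show ?case by (intro exI[of _ "1::int"] exI[of _ "2::int"]) simp
next
  case (Suc n)
  then obtain x y :: int where xy: "int n < x" "x < y" "x * x + y * y + 1 = 3 * x * y" by blast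
  have "y * y + (3 * y - x) * (3 * y - x) + 1 = 3 * y * (3 * y - x)"
    using xy(3) by (simp add: algebra_simps)
  moreover have "int (Suc n) < y" "y < 3 * y - x" using xy by simp_all
  ultimately show ?case by blast
qed

theorem theorem1:
  fixes m :: nat
  assumes "m > 4"
  shows "infinite {a. integral_closed_2_frieze m a}"
proof
  assume fin: "finite {a. integral_closed_2_frieze m a}"
  define k where "k = int m - 5"
  have k: "0 \<le> k" using assms by (simp add: k_def)
  define entry where "entry a = a (1::nat, 2 * k + 4)" for a :: "nat \<times> int \<Rightarrow> int"
  define B where "B = Max (entry ` {a. integral_closed_2_frieze m a})"
  \<comment> \<open>Parameters beyond \<open>B\<close> yield a frieze whose entry exceeds the
    supposed maximum.\<close>
  obtain x y :: int where xy: "int (nat B) < x" "x < y" "x * x + y * y + 1 = 3 * x * y"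
    using cap_parameters_unbounded by blast
  have "1 \<le> x" "x \<le> y" using xy(1,2) by linarith+
  note params = this xy(3)
  define a where "a = polygon_frieze m (\<lambda>i. vertex x y k (i mod (k + 9)))"
  have "integral_closed_2_frieze m a"
    unfolding a_def by (rule integral_polygon_frieze[OF params k_def k])
  then have "entry a \<le> B" unfolding B_def using fin by (intro Max_ge) auto
  moreover have "entry a = k + 4 * x + 13 * y"
    unfolding a_def entry_def by (rule polygon_frieze_entry[OF params k_def k])
  ultimately show False using xy(1,2) k by linarith
qed

end
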